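(* Let $G$ be either the De Bruijn digraph $B(d,D)$ or the Kautz digraph $K(d,D)$, with vertex set $V$, and let $\mathcal{V}_1,\dots,\mathcal{V}_l$ be the classes of the relation $\sim$ on $V$. Let $1\le i<D$. Then the transition probability $\mathbb{P}_{\mathsf{t}}(i,D)$ is given by $$\mathbb{P}_{\mathsf{t}}(i,D) = \frac{1}{(d-1) |V|}\sum_{r=1}^{l}\sum_{s=1}^{m_r} |\mathcal{V}_r|\, p^{(r,s,i)}\left(1-q^{(r,s,i)}\right),$$ where $m_r\in\{d-1,d\}$ if $G=K(d,D)$ and $m_r=d$ if $G=B(d,D)$, and where $p^{(r,s,i)}$ and $q^{(r,s,i)}$ are rational fractions in the degree $d$ of the form $$p^{(r,s,i)}=k^{(r,s,i)}\cdot \frac{d^i-\alpha^{(r,s,i)}_{i-1}d^{i-1}-\cdots -\alpha^{(r,s,i)}_{1} d-\alpha^{(r,s,i)}_{0}}{d^i-a^{(r,s,i)}_{i-1}d^{i-1}-\cdots -a^{(r,s,i)}_{1} d-a^{(r,s,i)}_{0}}$$ and $$q^{(r,s,i)}=\kappa^{(r,s,i)}\cdot \frac{d^{i-1}-b^{(r,s,i)}_{i-2}d^{i-2}-\cdots -b^{(r,s,i)}_{1} d-b^{(r,s,i)}_{0}}{d^i-a^{(r,s,i)}_{i-1}d^{i-1}-\cdots -a^{(r,s,i)}_{1} d-a^{(r,s,i)}_{0}},$$ where all the coefficients are $0$, $1$ or $2$. Namely, $k^{(r,s,i)}, \kappa^{(r,s,i)} \in\{0,1\}$; $\alpha^{(r,s,i)}_{i-1}\in\{0,1,2\}$;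 $a^{(r,s,i)}_{i-1}\in\{0,1\}$; and $\alpha^{(r,s,i)}_{m}, a^{(r,s,i)}_{m}, b^{(r,s,i)}_{m} \in\{0,1\}$ for $0\le m\le i-2$.
   Context: Let $d\ge 2$ and $D\ge 1$ be integers. The De Bruijn digraph $B(d,D)$ has as vertices all words $v=v_1v_2\cdots v_D$ over an alphabet $A$ with $|A|=d$; $v$ is adjacent to the $d$ vertices $v_2\cdots v_D v_{D+1}$, $v_{D+1}\in A$ (loops occur). The Kautz digraph $K(d,D)$ has as vertices all words $v=v_1v_2\cdots v_D$ over an alphabet $A$ with $|A|=d+1$ such that $v_k\ne v_{k+1}$ for $1\le k<D$; $v$ is adjacent to the $d$ vertices $v_2\cdots v_Dv_{D+1}$ with $v_{D+1}\in A$, $v_{D+1}\ne v_D$. Both are $d$-regular of diameter $D$, and the shortest path between any two vertices is unique. For $v\in V$ and $i\ge 0$, $S_i(v)$ is the set of vertices $u$ for which there is a walk of length exactly $i$ from $v$ to $u$ (so $S_1(v)$ is the set of vertices adjacent from $v$), and $S_i^\star(v)$ is the set of vertices at (directed) distance exactly $i$ from $v$. Equivalence relation on $V$: $v_1\cdots v_D\sim v'_1\cdots v'_D$ if and only if there is a permutation $\sigma$ of the alphabet $A$ with $\sigma(v_k)=v'_k$ for $1\le k\le D$. Its classes are $\mathcal{V}_1,\dots,\mathcal{V}_l$. Transition probability: $\mathbb{P}_{\mathsf{t}}(i,j)$ is the probability that a packet which is deflected at a vertex $v$ at distance $i$ from its destination $z$ is, after the deflection to a vertex $w$ adjacent from $v$,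 at distance $j$ from $z$. It is computed in the following model. The vertex $v$ is uniform on $V$, and $$\mathbb{P}_{\mathsf{t}}(i,j)=\frac1{|V|}\sum_{v\in V}\ \sum_{w\in S_1(v)} \mathbb{P}_{\mathsf{t}}(i,j\mid v,w)\,\mathbb{P}(w\mid v),\qquad \mathbb{P}_{\mathsf{t}}(i,j\mid v,w)=\frac{|S_i^\star(v)\cap S_j^\star(w)|}{|S_i^\star(v)|},$$ where $$\mathbb{P}(w\mid v)=\frac{1}{|S_i^\star(v)|}\sum_{z\in S_i^\star(v)}\mathbb{P}(w\mid v,z),$$ with $\mathbb{P}(w\mid v,z)=0$ if $w$ is the vertex adjacent from $v$ on the unique shortest path from $v$ to $z$, and $\mathbb{P}(w\mid v,z)=1/(d-1)$ for every other $w\in S_1(v)$. *)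

theory Defs
  imports "Graph_Theory.Graph_Theory" "HOL-Combinatorics.Permutations"
begin

section \<open>De Bruijn and Kautz digraphs\<close>

definition de_bruijn :: "'a set \<Rightarrow> nat \<Rightarrow> ('a list, 'a list \<times> 'a list) pre_digraph" where
  "de_bruijn A D =
    \<lparr> verts = {v. length v = D \<and> set v \<subseteq> A},
      arcs = {(v, w). length v = D \<and> set v \<subseteq> A \<and> (\<exists>x\<in>A. w = tl v @ [x])},
      tail = fst, head = snd \<rparr>"

definition kautz_words :: "'a set \<Rightarrow> nat \<Rightarrow> 'a list set" where
  "kautz_words A D =
    {v. length v = D \<and> set v \<subseteq> A \<and> (\<forall>k. Suc k < D \<longrightarrow> v ! k \<noteq> v ! Suc k)}"

definition kautz :: "'a set \<Rightarrow> nat \<Rightarrow> ('a list, 'a list \<times> 'a list) pre_digraph" where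
  "kautz A D =
    \<lparr> verts = kautz_words A D,
      arcs = {(v, w). v \<in> kautz_words A D \<and> (\<exists>x\<in>A. x \<noteq> last v \<and> w = tl v @ [x])},
      tail = fst, head = snd \<rparr>"

lemma set_tl_subset: "set (tl v) \<subseteq> set v"
  by (cases v) auto

lemma wf_digraph_de_bruijn: "D \<ge> 1 \<Longrightarrow> wf_digraph (de_bruijn A D)"
  by unfold_locales (use set_tl_subset in \<open>fastforce simp: de_bruijn_def\<close>)+

lemma wf_digraph_kautz:
  assumes "D \<ge> 1"
  shows "wf_digraph (kautz A D)"
proof
  fix e assume "e \<in> arcs (kautz A D)"
  then obtain v x where e: "e = (v, tl v @ [x])" and v: "v \<in> kautz_words A D"
      and x: "x \<in> A" "x \<noteq> last v"
    by (auto simp: kautz_def)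
  show "tail (kautz A D) e \<in> verts (kautz A D)"
    using e v by (simp add: kautz_def)
  have len: "length v = D" and sub: "set v \<subseteq> A"
    and neq: "\<And>k. Suc k < D \<Longrightarrow> v ! k \<noteq> v ! Suc k"
    using v by (auto simp: kautz_words_def)
  have "(tl v @ [x]) ! k \<noteq> (tl v @ [x]) ! Suc k" if k: "Suc k < D" for k
  proof (cases "Suc (Suc k) < D")
    case True
    then show ?thesis using neq[of "Suc k"] len by (auto simp: nth_append nth_tl)
  next
    case False
    with k have D: "D = Suc (Suc k)" by simp
    then have "last v = v ! Suc k" using len by (subst last_conv_nth) auto
    then show ?thesis using D len x by (simp add: nth_append nth_tl)
  qed
  then show "head (kautz A D) e \<in> verts (kautz A D)"
    using e len sub x assms by (auto simp: kautz_def kautz_words_def dest: set_tl_subset[THEN subsetD])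
qed

definition word_equiv :: "'a set \<Rightarrow> 'a list set \<Rightarrow> ('a list \<times> 'a list) set" where
  "word_equiv A V = {(v, v'). v \<in> V \<and> v' \<in> V \<and> (\<exists>\<sigma>. \<sigma> permutes A \<and> map \<sigma> v = v')}"

section \<open>Walks, distances and deflection probabilities\<close>

definition walk_sphere :: "('v, 'e) pre_digraph \<Rightarrow> nat \<Rightarrow> 'v \<Rightarrow> 'v set" where
  "walk_sphere G i v = {u. \<exists>p. pre_digraph.awalk G v p u \<and> length p = i}"

text \<open>With all arc weights equal to 1, \<open>wf_digraph.\<mu>\<close> is the directed distance (infinite if there is
  no walk). Its defining equation requires \<open>wf_digraph\<close>, hence the two lemmas above.\<close>

definition ddist :: "('v, 'e) pre_digraph \<Rightarrow> 'v \<Rightarrow> 'v \<Rightarrow> ereal" where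
  "ddist G v u = wf_digraph.\<mu> G (\<lambda>_. 1) v u"

definition dist_sphere :: "('v, 'e) pre_digraph \<Rightarrow> nat \<Rightarrow> 'v \<Rightarrow> 'v set" where
  "dist_sphere G i v = {u \<in> verts G. ddist G v u = ereal (real i)}"

text \<open>In the two families of digraphs above shortest paths are unique, so the existential quantifier
  selects the successor of \<open>v\<close> on the shortest path to \<open>z\<close>.\<close>

definition on_shortest_path ::
    "('v, 'e) pre_digraph \<Rightarrow> 'v \<Rightarrow> 'v \<Rightarrow> 'v \<Rightarrow> bool" where
  "on_shortest_path G v z w \<longleftrightarrow>
    (\<exists>p. pre_digraph.awalk G v p z \<and> ereal (real (length p)) = ddist G v z \<and>
         p \<noteq> [] \<and> head G (hd p) = w)"

text \<open>The probability that a packet at \<open>v\<close> with destination \<open>z\<close> is deflected to the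
  out-neighbour \<open>w\<close> of \<open>v\<close>; \<open>d\<close> is the out-degree.\<close>

definition defl_prob_dest ::
    "('v, 'e) pre_digraph \<Rightarrow> nat \<Rightarrow> 'v \<Rightarrow> 'v \<Rightarrow> 'v \<Rightarrow> real" where
  "defl_prob_dest G d w v z = (if on_shortest_path G v z w then 0 else 1 / (real d - 1))"

definition defl_prob ::
    "('v, 'e) pre_digraph \<Rightarrow> nat \<Rightarrow> nat \<Rightarrow> 'v \<Rightarrow> 'v \<Rightarrow> real" where
  "defl_prob G d i w v =
    1 / real (card (dist_sphere G i v)) * (\<Sum>z\<in>dist_sphere G i v. defl_prob_dest G d w v z)"

definition trans_prob_given ::
    "('v, 'e) pre_digraph \<Rightarrow> nat \<Rightarrow> nat \<Rightarrow> 'v \<Rightarrow> 'v \<Rightarrow> real" where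
  "trans_prob_given G i j v w =
    real (card (dist_sphere G i v \<inter> dist_sphere G j w)) / real (card (dist_sphere G i v))"

definition trans_prob :: "('v, 'e) pre_digraph \<Rightarrow> nat \<Rightarrow> nat \<Rightarrow> nat \<Rightarrow> real" where
  "trans_prob G d i j =
    1 / real (card (verts G)) *
    (\<Sum>v\<in>verts G. \<Sum>w\<in>walk_sphere G 1 v. trans_prob_given G i j v w * defl_prob G d i w v)"

end

theory Submission
  imports Defs
begin

text \<open>
  Write \<open>S\<^sub>j(v)\<close> for the set of vertices reached from \<open>v\<close> by walks of length exactly \<open>j\<close>. Both
  families of digraphs shift words, so for \<open>j < D\<close> the set \<open>S\<^sub>j(v)\<close> is a cylinder: it consists of all
  words whose first \<open>D - j\<close> letters are the last \<open>D - j\<close> letters of \<open>v\<close>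
  (\<open>S_eq_cylinder\<close>). Hence any two of these sets, even for different vertices, are nested or
  disjoint (\<open>S_laminar\<close>), and they have exactly \<open>d\<^sup>j\<close> elements (\<open>card_S\<close>). In a laminar
  family with one member of size \<open>d\<^sup>j\<close> for each \<open>j\<close>, the union is the disjoint union of the maximal
  members, so its size is \<open>\<Sum> a\<^sub>j d\<^sup>j\<close> with digits \<open>a\<^sub>j\<close> in \<open>{0, 1}\<close>
  (\<open>card_UN_laminar\<close>).

  The vertices at distance \<open>i\<close> from \<open>v\<close> are those of \<open>S\<^sub>i(v)\<close> outside every \<open>S\<^sub>j(v)\<close>, \<open>j < i\<close>, which
  gives the common denominator. For an out-neighbour \<open>w\<close> of \<open>v\<close>, a vertex at distance \<open>i\<close> from \<open>v\<close> has
  its shortest path through \<open>w\<close> iff it lies in \<open>S\<^sub>i\<^sub>-\<^sub>1(w)\<close>; counting these gives \<open>q\<close>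
  (\<open>card_through_neighbour\<close>). For \<open>p\<close> one removes from \<open>S\<^sub>i(v)\<close> also all \<open>S\<^sub>j(w)\<close> with \<open>j < D\<close>. Those
  with \<open>j \<ge> i\<close> are either disjoint from \<open>S\<^sub>i(v)\<close> or swallow it, whence the factor \<open>k\<close>; those with
  \<open>j < i - 1\<close> are contained in \<open>S\<^sub>j\<^sub>+\<^sub>1(v)\<close>, which is removed anyway. Only \<open>S\<^sub>i\<^sub>-\<^sub>1(w)\<close> remains, and it
  is the reason why just the digit of index \<open>i - 1\<close> can be \<open>2\<close>
  (\<open>card_deflected_to_D\<close>).

  Finally, a permutation of the alphabet acts as an automorphism, so all vertices of one class
  contribute equally, and the average over \<open>V\<close> is a sum over representatives of the classes and over
  their \<open>d\<close> out-neighbours (\<open>sum_weight_by_classes\<close>). Thus \<open>m\<^sub>r = d\<close> works for both families: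
  out-neighbours with \<open>p = 0\<close> are kept in the sum.
\<close>

section \<open>Laminar families with one set of each size\<close>

text \<open>
  The digits mark the members that are maximal under inclusion. The index set \<open>J\<close> is arbitrary so
  that the induction, which splits off the largest set, can continue with only those sets that are
  disjoint from it.
\<close>

lemma card_UN_laminar:
  fixes S :: "nat \<Rightarrow> 'b set" and d :: nat
  assumes "\<And>j. j < n \<Longrightarrow> finite (S j)" and "\<And>j. j < n \<Longrightarrow> card (S j) = d ^ j"
    and "\<And>j k. j < k \<Longrightarrow> k < n \<Longrightarrow> S j \<subseteq> S k \<or> S j \<inter> S k = {}"
  shows "\<exists>a :: nat \<Rightarrow> nat. (\<forall>j. a j \<in> {0, 1}) \<and> card (\<Union>j\<in>J \<inter> {..<n}. S j) = (\<Sum>j<n. a j * d ^ j)"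
  using assms
proof (induction n arbitrary: J)
  case 0
  show ?case by (auto intro!: exI[of _ "\<lambda>_. 0"])
next
  case (Suc n)
  define J' where "J' = (if n \<in> J then {j \<in> J. S j \<inter> S n = {}} else J)"
  obtain a :: "nat \<Rightarrow> nat" where a: "\<forall>j. a j \<in> {0, 1}"
    and card_a: "card (\<Union>j\<in>J' \<inter> {..<n}. S j) = (\<Sum>j<n. a j * d ^ j)"
    using Suc.IH[of J'] Suc.prems by auto
  have card_upd: "(\<Sum>j<n. (a(n := c)) j * d ^ j) = (\<Sum>j<n. a j * d ^ j)" for c
    by (intro sum.cong) auto
  show ?case
  proof (cases "n \<in> J")
    case True
    have "(\<Union>j\<in>J \<inter> {..<Suc n}. S j) = S n \<union> (\<Union>j\<in>J' \<inter> {..<n}. S j)"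
    proof -
      have "S j \<subseteq> S n" if "j < n" "S j \<inter> S n \<noteq> {}" for j
        using Suc.prems(3)[of j n] that by auto
      then show ?thesis
        using True by (fastforce simp: J'_def less_Suc_eq)
    qed
    moreover have "S n \<inter> (\<Union>j\<in>J' \<inter> {..<n}. S j) = {}"
      using True by (auto simp: J'_def)
    moreover have "finite (\<Union>j\<in>J' \<inter> {..<n}. S j)"
      using Suc.prems(1) by auto
    ultimately have "card (\<Union>j\<in>J \<inter> {..<Suc n}. S j) = (\<Sum>j<Suc n. (a(n := 1)) j * d ^ j)"
      using Suc.prems(1,2) card_a card_upd[of 1] by (simp add: card_Un_disjoint)
    then show ?thesis
      using a by (intro exI[of _ "a(n := 1)"]) auto
  next
    case False
    then have "J \<inter> {..<Suc n} = J' \<inter> {..<n}"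
      by (auto simp: J'_def less_Suc_eq)
    then have "card (\<Union>j\<in>J \<inter> {..<Suc n}. S j) = (\<Sum>j<Suc n. (a(n := 0)) j * d ^ j)"
      using card_a card_upd[of 0] by simp
    then show ?thesis
      using a by (intro exI[of _ "a(n := 0)"]) auto
  qed
qed

text \<open>Ensures that the distance spheres, and with them the denominators, do not vanish.\<close>

lemma sum_digits_less_power:
  fixes a :: "nat \<Rightarrow> nat"
  assumes "d \<ge> 2" and "\<And>j. a j \<in> {0, 1}"
  shows "(\<Sum>j<n. a j * d ^ j) < d ^ n"
proof (induction n)
  case (Suc n)
  have "a n * d ^ n \<le> d ^ n"
    using assms(2)[of n] by auto
  moreover have "2 * d ^ n \<le> d * d ^ n"
    using assms(1) by (intro mult_right_mono) auto
  ultimately have "(\<Sum>j<n. a j * d ^ j) + a n * d ^ n < d * d ^ n"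
    using Suc.IH by linarith
  then show ?case
    by simp
qed simp

section \<open>Walks and distances\<close>

context wf_digraph
begin

lemma walk_sphere_0: "v \<in> verts G \<Longrightarrow> walk_sphere G 0 v = {v}"
  by (auto simp: walk_sphere_def awalk_Nil_iff)

lemma walk_sphere_subset_verts: "walk_sphere G i v \<subseteq> verts G"
  by (auto simp: walk_sphere_def)

lemma walk_sphere_1: "walk_sphere G 1 v = {w. \<exists>e\<in>arcs G. tail G e = v \<and> head G e = w}"
proof -
  have "awalk v [e] w \<longleftrightarrow> e \<in> arcs G \<and> tail G e = v \<and> head G e = w" for e w
    by (auto simp: awalk_Cons_iff awalk_Nil_iff)
  then show ?thesis
    unfolding walk_sphere_def by (auto simp: length_Suc_conv)
qed

lemma walk_sphere_Suc: "walk_sphere G (Suc i) v = (\<Union>w\<in>walk_sphere G 1 v. walk_sphere G i w)"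
proof -
  have "u \<in> walk_sphere G (Suc i) v \<longleftrightarrow> (\<exists>e p. awalk v (e # p) u \<and> length p = i)" for u
    unfolding walk_sphere_def by (auto simp: length_Suc_conv)
  then show ?thesis
    unfolding walk_sphere_1 by (auto simp: awalk_Cons_iff walk_sphere_def)
qed

text \<open>
  The infimum that defines the distance is taken over lengths of walks, hence it is either infinite or
  attained at the least length.
\<close>

lemma ddist_eq_iff:
  "ddist G v u = ereal (real i) \<longleftrightarrow> u \<in> walk_sphere G i v \<and> (\<forall>j<i. u \<notin> walk_sphere G j v)"
proof -
  define N where "N = {n. u \<in> walk_sphere G n v}"
  have cost: "awalk_cost (\<lambda>_. 1) p = real (length p)" for p
    by (induction p) auto
  have ddist: "ddist G v u = (INF n\<in>N. ereal (real n))"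
  proof -
    have "N = length ` {p. awalk v p u}"
      by (auto simp: N_def walk_sphere_def)
    then show ?thesis
      by (simp add: ddist_def \<mu>_def cost image_image)
  qed
  show ?thesis
  proof (cases "N = {}")
    case True
    then show ?thesis
      using ddist by (auto simp: N_def top_ereal_def)
  next
    case False
    define n where "n = (LEAST n. n \<in> N)"
    have n: "n \<in> N" "\<And>j. j \<in> N \<Longrightarrow> n \<le> j"
      using False by (auto simp: n_def intro: LeastI Least_le)
    have "ddist G v u = ereal (real n)"
      unfolding ddist using n by (intro antisym INF_lower INF_greatest) auto
    moreover have "n = i \<longleftrightarrow> i \<in> N \<and> (\<forall>j<i. j \<notin> N)"
      using n by (metis leD linorder_neqE_nat)
    ultimately show ?thesis
      by (simp add: N_def)
  qed
qed

lemma dist_sphere_eq: "dist_sphere G i v = walk_sphere G i v - (\<Union>j<i. walk_sphere G j v)"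
  using walk_sphere_subset_verts by (auto simp: dist_sphere_def ddist_eq_iff)

lemma on_shortest_path_iff:
  assumes "z \<in> dist_sphere G i v" and "i \<ge> 1" and "w \<in> walk_sphere G 1 v"
  shows "on_shortest_path G v z w \<longleftrightarrow> z \<in> walk_sphere G (i - 1) w"
proof
  have i: "ddist G v z = ereal (real i)"
    using assms(1) by (simp add: dist_sphere_def)
  show "z \<in> walk_sphere G (i - 1) w" if path: "on_shortest_path G v z w"
  proof -
    obtain p where p: "awalk v p z" "ereal (real (length p)) = ddist G v z"
        "p \<noteq> []" "head G (hd p) = w"
      using path unfolding on_shortest_path_def by blast
    moreover have "length p = i"
      using p(2) i by simp
    ultimately show ?thesis
      by (cases p) (auto simp: walk_sphere_def awalk_Cons_iff)
  qed
  show "on_shortest_path G v z w" if z: "z \<in> walk_sphere G (i - 1) w"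
  proof -
    obtain e p where "e \<in> arcs G" "tail G e = v" "head G e = w" "awalk w p z" "length p = i - 1"
      using z assms(3) unfolding walk_sphere_1 by (auto simp: walk_sphere_def)
    then show ?thesis
      using i assms(2) unfolding on_shortest_path_def
      by (intro exI[of _ "e # p"]) (auto simp: awalk_Cons_iff)
  qed
qed

text \<open>
  A packet is deflected to \<open>w\<close> only if its destination is not in \<open>S\<^sub>i\<^sub>-\<^sub>1(w)\<close>, and then with probability
  \<open>1 / (d - 1)\<close>; averaging over the destinations produces the factor \<open>1 - q\<close>.
\<close>

lemma trans_prob_given_mult_defl_prob:
  assumes "i \<ge> 1" and "w \<in> walk_sphere G 1 v" and "finite (verts G)"
    and "dist_sphere G i v \<noteq> {}"
  shows "trans_prob_given G i j v w * defl_prob G d i w v =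
    1 / (real d - 1) *
    (real (card (dist_sphere G i v \<inter> dist_sphere G j w)) / real (card (dist_sphere G i v))) *
    (1 - real (card (dist_sphere G i v \<inter> walk_sphere G (i - 1) w)) / real (card (dist_sphere G i v)))"
proof -
  define E where "E = dist_sphere G i v"
  have fin: "finite E"
    using assms(3) by (auto simp: E_def dist_sphere_def)
  then have pos: "card E > 0"
    using assms(4) by (auto simp: E_def card_gt_0_iff)
  have "(\<Sum>z\<in>E. defl_prob_dest G d w v z) =
      (\<Sum>z\<in>E. if z \<in> walk_sphere G (i - 1) w then 0 else 1 / (real d - 1))"
    using on_shortest_path_iff[OF _ assms(1,2)]
    by (intro sum.cong) (auto simp: E_def defl_prob_dest_def)
  also have "\<dots> = real (card (E - walk_sphere G (i - 1) w)) / (real d - 1)"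
    using fin by (simp add: sum.If_cases Diff_eq)
  also have "real (card (E - walk_sphere G (i - 1) w)) =
      real (card E) - real (card (E \<inter> walk_sphere G (i - 1) w))"
    using fin by (simp add: card_Diff_subset_Int card_mono of_nat_diff)
  finally show ?thesis
    using pos unfolding trans_prob_given_def defl_prob_def E_def[symmetric]
    by (simp add: field_simps)
qed

end

section \<open>Digraphs of overlapping words\<close>

text \<open>
  De Bruijn and Kautz digraphs are treated together: \<open>R\<close> says which letters may follow each other, all
  of them in the first case and all different ones in the second.
\<close>

definition overlap_words :: "('a \<Rightarrow> 'a \<Rightarrow> bool) \<Rightarrow> 'a set \<Rightarrow> nat \<Rightarrow> 'a list set" where
  "overlap_words R A D = {v. length v = D \<and> set v \<subseteq> A \<and> successively R v}"

definition overlap_digraph ::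
    "('a \<Rightarrow> 'a \<Rightarrow> bool) \<Rightarrow> 'a set \<Rightarrow> nat \<Rightarrow> ('a list, 'a list \<times> 'a list) pre_digraph" where
  "overlap_digraph R A D =
    \<lparr> verts = overlap_words R A D,
      arcs = {(v, w). v \<in> overlap_words R A D \<and> (\<exists>x\<in>A. R (last v) x \<and> w = tl v @ [x])},
      tail = fst, head = snd \<rparr>"

lemma de_bruijn_eq_overlap_digraph: "de_bruijn A D = overlap_digraph (\<lambda>_ _. True) A D"
proof -
  have "successively (\<lambda>_ _. True) v" for v :: "'a list"
    by (induction v) (auto simp: successively_Cons)
  then show ?thesis
    by (simp add: de_bruijn_def overlap_digraph_def overlap_words_def)
qed

lemma kautz_eq_overlap_digraph: "kautz A D = overlap_digraph (\<noteq>) A D"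
proof -
  have "successively (\<noteq>) v \<longleftrightarrow> (\<forall>k. Suc k < length v \<longrightarrow> v ! k \<noteq> v ! Suc k)" for v :: "'a list"
  proof (induction v)
    case (Cons x v)
    then show ?case
      by (cases v) (auto simp: nth_Cons less_Suc_eq_0_disj split: nat.splits)
  qed simp
  then have "kautz_words A D = overlap_words (\<noteq>) A D"
    by (auto simp: kautz_words_def overlap_words_def)
  then show ?thesis
    unfolding kautz_def overlap_digraph_def by (simp only: neq_commute[of "last _"])
qed

text \<open>
  What the proof uses about \<open>R\<close>. The out-degree condition gives \<open>d\<close>-regularity, invariance makes
  permutations of the alphabet act as automorphisms, and \<open>eq_if_not_R\<close> bounds the diameter: if \<open>v\<close>
  cannot be followed directly by the first letter of \<open>z\<close>, then the last letter of \<open>v\<close> is the first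
  letter of \<open>z\<close>, and the two words overlap.
\<close>

locale word_digraph =
  fixes R :: "'a \<Rightarrow> 'a \<Rightarrow> bool" and A :: "'a set" and d D :: nat
  assumes d_ge_2: "d \<ge> 2" and D_pos: "D \<ge> 1" and finite_A: "finite A"
    and out_degree: "a \<in> A \<Longrightarrow> card {x \<in> A. R a x} = d"
    and eq_if_not_R: "\<not> R a b \<Longrightarrow> a = b"
    and R_invariant: "inj \<sigma> \<Longrightarrow> R (\<sigma> a) (\<sigma> b) \<longleftrightarrow> R a b"
begin

abbreviation "G \<equiv> overlap_digraph R A D"
abbreviation "V \<equiv> overlap_words R A D"
abbreviation "S \<equiv> walk_sphere G"

lemma verts_G [simp]: "verts G = V"
  by (simp add: overlap_digraph_def)

lemma length_word: "v \<in> V \<Longrightarrow> length v = D"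
  by (simp add: overlap_words_def)

lemma word_nonempty: "v \<in> V \<Longrightarrow> v \<noteq> []"
  using length_word[of v] D_pos by force

lemma set_word: "v \<in> V \<Longrightarrow> set v \<subseteq> A"
  by (simp add: overlap_words_def)

lemma last_in_A: "v \<in> V \<Longrightarrow> last v \<in> A"
  using word_nonempty[of v] set_word[of v] by (meson last_in_set subsetD)

lemma shift_in_V:
  assumes "v \<in> V" and "x \<in> A" and "R (last v) x"
  shows "tl v @ [x] \<in> V"
proof -
  obtain a u where v: "v = a # u"
    using word_nonempty[OF assms(1)] by (cases v) auto
  have u: "length u = D - 1" "set u \<subseteq> A" "successively R u" "u \<noteq> [] \<longrightarrow> last u = last v"
    using assms(1) by (auto simp: v overlap_words_def successively_Cons)
  have "successively R (u @ [x])"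
    using u(3,4) assms(3) by (cases "u = []") (simp_all add: successively_append_iff)
  then show ?thesis
    using u(1,2) assms(2) D_pos by (simp add: v overlap_words_def)
qed

sublocale wf_digraph G
proof
  fix e assume "e \<in> arcs G"
  then obtain v x where e: "e = (v, tl v @ [x])" and vx: "v \<in> V" "x \<in> A" "R (last v) x"
    unfolding overlap_digraph_def by auto
  show "tail G e \<in> verts G"
    unfolding verts_G using e vx(1) by (simp add: overlap_digraph_def)
  show "head G e \<in> verts G"
    unfolding verts_G using e shift_in_V[OF vx] by (simp add: overlap_digraph_def)
qed

lemma finite_V: "finite V"
  using finite_lists_length_eq[OF finite_A, of D]
  by (rule finite_subset[rotated]) (auto simp: overlap_words_def)

lemma S_subset_V: "S i v \<subseteq> V"
  using walk_sphere_subset_verts by simp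

lemma finite_S [simp]: "finite (S i v)"
  using S_subset_V finite_V by (rule finite_subset)

lemma S_1: "v \<in> V \<Longrightarrow> S 1 v = (\<lambda>x. tl v @ [x]) ` {x \<in> A. R (last v) x}"
  unfolding walk_sphere_1 by (auto simp: overlap_digraph_def)

lemma card_S_1: "v \<in> V \<Longrightarrow> card (S 1 v) = d"
  unfolding S_1 using out_degree[OF last_in_A] by (simp add: card_image inj_on_def)

lemma S_Suc_iff:
  assumes "v \<in> V"
  shows "z \<in> S (Suc j) v \<longleftrightarrow> (\<exists>x\<in>A. R (last v) x \<and> z \<in> S j (tl v @ [x]))"
  unfolding walk_sphere_Suc[of j] S_1[OF assms] by blast

lemma S_subset_S_Suc: "w \<in> S 1 v \<Longrightarrow> S j w \<subseteq> S (Suc j) v"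
  unfolding walk_sphere_Suc[of j] by blast

text \<open>
  The suffix of \<open>v\<close> that survives \<open>j\<close> shifts is nonempty because \<open>j < D\<close>. Therefore the last letter of
  \<open>v\<close> is still present in \<open>z\<close>, and the admissibility of \<open>z\<close> as a word already contains the condition
  on the first letter appended after \<open>v\<close>.
\<close>

lemma S_eq_cylinder:
  assumes "v \<in> V" and "j < D"
  shows "S j v = {z \<in> V. take (D - j) z = drop j v}"
  using assms
proof (induction j arbitrary: v)
  case 0
  then show ?case
    by (auto simp: walk_sphere_0 length_word)
next
  case (Suc j)
  define n where "n = D - Suc (Suc j)"
  have n: "D - j = Suc (Suc n)" "D - Suc j = Suc n"
    using Suc.prems by (auto simp: n_def)
  have drop_v: "drop (Suc j) v \<noteq> []" "last (drop (Suc j) v) = last v"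
      "length (drop (Suc j) v) = Suc n"
    using Suc.prems n by (auto simp: length_word)
  have "z \<in> S (Suc j) v \<longleftrightarrow>
      z \<in> V \<and> (\<exists>x\<in>A. R (last v) x \<and> take (D - j) z = drop (Suc j) v @ [x])" for z
  proof -
    have "drop j (tl v @ [x]) = drop (Suc j) v @ [x]" for x
      using Suc.prems by (simp add: drop_Suc length_word)
    then show ?thesis
      using Suc.IH[OF shift_in_V] Suc.prems S_Suc_iff by auto
  qed
  moreover have "(\<exists>x\<in>A. R (last v) x \<and> take (D - j) z = drop (Suc j) v @ [x]) \<longleftrightarrow>
      take (D - Suc j) z = drop (Suc j) v" if z: "z \<in> V" for z
  proof -
    have split: "z = take (Suc n) z @ z ! Suc n # drop (Suc (Suc n)) z" "Suc n < length z"
      using n Suc.prems length_word[OF z] by (auto simp: id_take_nth_drop)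
    have take: "take (D - j) z = take (Suc n) z @ [z ! Suc n]"
      unfolding n using split(2) by (rule take_Suc_conv_app_nth)
    have "z ! Suc n \<in> A"
      using set_word[OF z] split(2) by (meson nth_mem subsetD)
    moreover have "R (last v) (z ! Suc n)" if "take (Suc n) z = drop (Suc j) v"
    proof -
      have "successively R (take (Suc n) z @ z ! Suc n # drop (Suc (Suc n)) z)"
        using z split(1) by (simp add: overlap_words_def)
      then show ?thesis
        using that drop_v by (simp add: successively_append_iff)
    qed
    ultimately show ?thesis
      unfolding take n(2) using drop_v(3) split(2) by auto
  qed
  ultimately show ?case
    by auto
qed

lemma S_laminar:
  assumes "v \<in> V" "w \<in> V" "j \<le> k" "k < D"
  shows "S j v \<subseteq> S k w \<or> S j v \<inter> S k w = {}"
proof -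
  have cyl: "S j v = {z \<in> V. take (D - j) z = drop j v}" "S k w = {z \<in> V. take (D - k) z = drop k w}"
    using S_eq_cylinder[OF assms(1) le_less_trans[OF assms(3,4)]] S_eq_cylinder[OF assms(2,4)] .
  have "min (D - k) (D - j) = D - k"
    using assms(3) by linarith
  then have "take (D - k) y = take (D - k) (take (D - j) y)" for y :: "'a list"
    unfolding take_take by simp
  then have "take (D - k) y = drop k w"
    if "take (D - j) y = drop j v" "take (D - j) z = drop j v" "take (D - k) z = drop k w" for y z
    using that by metis
  then show ?thesis
    unfolding cyl by blast
qed

text \<open>
  Out-neighbours of \<open>v\<close> differ in their last letter, which still belongs to the prefix that
  defines \<open>S\<^sub>j\<close> as a cylinder when \<open>j < D\<close>. By induction, walks of length at most \<open>D\<close> are unique.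
\<close>

lemma S_1_disjoint:
  assumes "v \<in> V" "w \<in> S 1 v" "w' \<in> S 1 v" "w \<noteq> w'" "j < D"
  shows "S j w \<inter> S j w' = {}"
proof -
  obtain x x' where w: "w = tl v @ [x]" "w' = tl v @ [x']"
    using assms(2,3) unfolding S_1[OF assms(1)] by blast
  have "w \<in> V" "w' \<in> V"
    using assms(2,3) S_subset_V by blast+
  moreover have "drop j w \<noteq> drop j w'"
    using w assms(1,4,5) by (simp add: length_word)
  ultimately show ?thesis
    using S_eq_cylinder[of w j] S_eq_cylinder[of w' j] assms(5) by auto
qed

lemma card_S:
  assumes "v \<in> V" "j \<le> D"
  shows "card (S j v) = d ^ j"
  using assms
proof (induction j arbitrary: v)
  case 0
  then show ?case by (simp add: walk_sphere_0)
next
  case (Suc j)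
  have "card (S (Suc j) v) = (\<Sum>w\<in>S 1 v. card (S j w))"
    unfolding walk_sphere_Suc using Suc.prems S_1_disjoint by (intro card_UN_disjoint) auto
  also have "\<dots> = (\<Sum>w\<in>S 1 v. d ^ j)"
    using Suc S_subset_V by (intro sum.cong) auto
  finally show ?case
    using card_S_1 Suc.prems by simp
qed

text \<open>
  A word outside \<open>S\<^sub>D\<^sub>-\<^sub>1(v)\<close> does not begin with the last letter of \<open>v\<close>, so its letters can be
  appended to \<open>v\<close> one by one: the diameter is at most \<open>D\<close>.
\<close>

lemma dist_sphere_D:
  assumes "v \<in> V"
  shows "dist_sphere G D v = V - (\<Union>j<D. S j v)"
proof -
  have "z \<in> S D v" if z: "z \<in> V" "z \<notin> S (D - 1) v" for z
  proof -
    have "take 1 z = [hd z]"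
      using word_nonempty[OF z(1)] by (simp add: take_Suc)
    moreover have "drop (D - 1) v = [last v]"
      using word_nonempty[OF assms] assms by (metis append_butlast_last_id append_eq_conv_conj length_butlast length_word)
    ultimately have "last v \<noteq> hd z"
      using z D_pos assms by (auto simp: S_eq_cylinder)
    then have R: "R (last v) (hd z)"
      using eq_if_not_R by blast
    have hd: "hd z \<in> A"
      using set_word[OF z(1)] word_nonempty[OF z(1)] by (meson hd_in_set subsetD)
    have "z \<in> S (D - 1) (tl v @ [hd z])"
      using shift_in_V[OF assms hd R] \<open>take 1 z = [hd z]\<close> D_pos assms z(1)
      by (simp add: S_eq_cylinder length_word)
    then show ?thesis
      using S_Suc_iff[OF assms, of z "D - 1"] hd R D_pos by auto
  qed
  then show ?thesis
    unfolding dist_sphere_eq using S_subset_V D_pos by (auto simp: Ball_def)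
qed

section \<open>The cardinalities behind the transition probabilities\<close>

lemma card_UN_S:
  assumes "v \<in> V" "k \<le> D"
  shows "\<exists>a :: nat \<Rightarrow> nat. (\<forall>j. a j \<in> {0, 1}) \<and> card (\<Union>j\<in>J \<inter> {..<k}. S j v) = (\<Sum>j<k. a j * d ^ j)"
proof (rule card_UN_laminar)
  show "card (S j v) = d ^ j" if "j < k" for j
    using assms that by (intro card_S) auto
  show "S j v \<subseteq> S m v \<or> S j v \<inter> S m v = {}" if "j < m" "m < k" for j m
    using assms that by (intro S_laminar) auto
qed simp

text \<open>
  Used twice: with \<open>w = v\<close> for the size of a distance sphere, and with an out-neighbour \<open>w\<close> of \<open>v\<close> for
  the vertices whose shortest path from \<open>v\<close> leads through \<open>w\<close>.
\<close>

lemma card_S_Diff: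
  assumes "v \<in> V" "w \<in> V" "k < D"
  shows "\<exists>b :: nat \<Rightarrow> nat. (\<forall>j. b j \<in> {0, 1}) \<and>
    card (S k w - (\<Union>j<k. S j v)) + (\<Sum>j<k. b j * d ^ j) = d ^ k"
proof -
  define J where "J = {j. S j v \<subseteq> S k w}"
  obtain b :: "nat \<Rightarrow> nat" where b: "\<forall>j. b j \<in> {0, 1}"
    and card_b: "card (\<Union>j\<in>J \<inter> {..<k}. S j v) = (\<Sum>j<k. b j * d ^ j)"
    using card_UN_S[OF assms(1) less_imp_le[OF assms(3)], of J] by (elim exE conjE) (rule that)
  have "j \<in> J \<or> S j v \<inter> S k w = {}" if "j < k" for j
    unfolding J_def using S_laminar[OF assms(1,2) less_imp_le[OF that] assms(3)] by simp
  then have "S k w - (\<Union>j<k. S j v) = S k w - (\<Union>j\<in>J \<inter> {..<k}. S j v)"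
    by blast
  moreover have sub: "(\<Union>j\<in>J \<inter> {..<k}. S j v) \<subseteq> S k w"
    by (auto simp: J_def)
  ultimately have "card (S k w - (\<Union>j<k. S j v)) + (\<Sum>j<k. b j * d ^ j) = card (S k w)"
    using card_b card_mono[OF finite_S sub] by (simp add: card_Diff_subset finite_subset[OF sub])
  then show ?thesis
    using b card_S assms by auto
qed

text \<open>
  In the main case the vertices counted are those of \<open>S\<^sub>i(v)\<close> outside \<open>S\<^sub>i\<^sub>-\<^sub>1(w)\<close> and outside all
  \<open>S\<^sub>j(v)\<close> with \<open>j < i\<close>. What is removed is \<open>S\<^sub>i\<^sub>-\<^sub>1(w)\<close> together with those \<open>S\<^sub>j(v)\<close> inside \<open>S\<^sub>i(v)\<close>
  that are disjoint from it, so the digits are those of a laminar union, with the digit of index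
  \<open>i - 1\<close> raised by one.
\<close>

lemma card_deflected_to_D:
  assumes "v \<in> V" "w \<in> S 1 v" "1 \<le> i" "i < D"
  shows "\<exists>(k :: nat) (\<alpha> :: nat \<Rightarrow> nat). k \<in> {0, 1} \<and> \<alpha> (i - 1) \<in> {0, 1, 2} \<and>
    (\<forall>j<i - 1. \<alpha> j \<in> {0, 1}) \<and>
    real (card (dist_sphere G i v \<inter> dist_sphere G D w)) =
      real k * (real d ^ i - (\<Sum>j<i. real (\<alpha> j) * real d ^ j))"
proof (cases "\<exists>j. i \<le> j \<and> j < D \<and> S i v \<inter> S j w \<noteq> {}")
  have w: "w \<in> V"
    using assms S_subset_V by auto
  case True
  then obtain j where "j < D" "S i v \<subseteq> S j w"
    using S_laminar assms(1) w by blast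
  then have "dist_sphere G i v \<inter> dist_sphere G D w = {}"
    unfolding dist_sphere_D[OF w] unfolding dist_sphere_eq by blast
  then show ?thesis
    by (intro exI[of _ 0] exI[of _ "\<lambda>_. 0"]) simp
next
  case False
  have w: "w \<in> V"
    using assms S_subset_V by auto
  note step = S_subset_S_Suc[OF assms(2)]
  have sub: "S (i - 1) w \<subseteq> S i v"
    using step[of "i - 1"] assms(3) by simp
  define J where "J = {j. S j v \<subseteq> S i v \<and> S j v \<inter> S (i - 1) w = {}}"
  define U where "U = (\<Union>j\<in>J \<inter> {..<i}. S j v)"
  obtain a :: "nat \<Rightarrow> nat" where a: "\<forall>j. a j \<in> {0, 1}"
    and card_a: "card U = (\<Sum>j<i. a j * d ^ j)"
    using card_UN_S[OF assms(1) less_imp_le[OF assms(4)], of J, folded U_def] by (elim exE conjE) (rule that)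
  have "dist_sphere G i v \<inter> dist_sphere G D w =
      S i v - (\<Union>j<i. S j v) - (\<Union>j<D. S j w)"
    unfolding dist_sphere_D[OF w] unfolding dist_sphere_eq using S_subset_V[of i v] by blast
  \<comment> \<open>\<open>S\<^sub>j(w)\<close> misses \<open>S\<^sub>i(v)\<close> for \<open>j \<ge> i\<close> and is covered by \<open>S\<^sub>j\<^sub>+\<^sub>1(v)\<close> for \<open>j < i - 1\<close>.\<close>
  also have "\<dots> = S i v - (\<Union>j<i. S j v) - S (i - 1) w"
  proof -
    have "z \<in> S (i - 1) w \<or> (\<exists>j<i. z \<in> S j v)" if "z \<in> S j w" "j < D" "z \<in> S i v" for z j
    proof (cases "j < i - 1")
      case True
      then show ?thesis
        using step[of j] that by (intro disjI2 exI[of _ "Suc j"]) auto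
    next
      case j: False
      then have "j = i - 1"
        using False that by (cases "i \<le> j") auto
      then show ?thesis
        using that by simp
    qed
    moreover have "i - 1 < D"
      using assms by simp
    ultimately show ?thesis
      by blast
  qed
  also have "\<dots> = S i v - (S (i - 1) w \<union> U)"
  proof -
    have "S j v \<inter> S i v = {} \<or> S j v \<subseteq> S (i - 1) w \<or> j \<in> J" if "j < i" for j
    proof -
      have "S j v \<subseteq> S (i - 1) w \<or> S j v \<inter> S (i - 1) w = {}"
        using that assms w by (intro S_laminar) auto
      moreover have "S j v \<subseteq> S i v \<or> S j v \<inter> S i v = {}"
        using that assms by (intro S_laminar) auto
      ultimately show ?thesis
        by (auto simp: J_def)
    qed
    then show ?thesis
      unfolding U_def by blast
  qed
  finally have eq: "dist_sphere G i v \<inter> dist_sphere G D w = S i v - (S (i - 1) w \<union> U)" .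
  have finite_U: "finite U" and disj: "S (i - 1) w \<inter> U = {}" and sub': "S (i - 1) w \<union> U \<subseteq> S i v"
    using sub by (auto simp: U_def J_def)
  define \<alpha> where "\<alpha> = a(i - 1 := Suc (a (i - 1)))"
  have "card (S (i - 1) w \<union> U) = (\<Sum>j<i. \<alpha> j * d ^ j)"
  proof -
    have "card (S (i - 1) w \<union> U) = d ^ (i - 1) + (\<Sum>j<i. a j * d ^ j)"
      using finite_U disj card_a card_S[OF w, of "i - 1"] assms(4) by (simp add: card_Un_disjoint)
    also have "\<dots> = (\<Sum>j<i. (if j = i - 1 then d ^ j else 0) + a j * d ^ j)"
      using assms(3) by (simp add: sum.distrib)
    also have "\<dots> = (\<Sum>j<i. \<alpha> j * d ^ j)"
      by (intro sum.cong) (auto simp: \<alpha>_def)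
    finally show ?thesis .
  qed
  then have "real (card (dist_sphere G i v \<inter> dist_sphere G D w)) =
      real (d ^ i) - real (\<Sum>j<i. \<alpha> j * d ^ j)"
    unfolding eq using card_mono[OF finite_S sub'] card_S[OF assms(1), of i] assms(4) finite_U sub'
    by (simp add: card_Diff_subset of_nat_diff)
  moreover have "\<alpha> (i - 1) \<in> {0, 1, 2}" "\<forall>j<i - 1. \<alpha> j \<in> {0, 1}"
    using a by (auto simp: \<alpha>_def)
  ultimately show ?thesis
    by (intro exI[of _ 1] exI[of _ \<alpha>]) simp
qed

text \<open>
  \<open>S\<^sub>i\<^sub>-\<^sub>1(v)\<close> and \<open>S\<^sub>i\<^sub>-\<^sub>1(w)\<close> have equal size, so they are disjoint or equal. In the second case no
  vertex at distance \<open>i\<close> is reached through \<open>w\<close>; in the first only \<open>S\<^sub>j(v)\<close> with \<open>j < i - 1\<close> matter,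
  and the leading term is \<open>d\<^sup>i\<^sup>-\<^sup>1\<close>.
\<close>

lemma card_through_neighbour:
  assumes "v \<in> V" "w \<in> S 1 v" "1 \<le> i" "i < D"
  shows "\<exists>(\<kappa> :: nat) (b :: nat \<Rightarrow> nat). \<kappa> \<in> {0, 1} \<and> (\<forall>j. b j \<in> {0, 1}) \<and>
    real (card (dist_sphere G i v \<inter> S (i - 1) w)) =
      real \<kappa> * (real d ^ (i - 1) - (\<Sum>j<i - 1. real (b j) * real d ^ j))"
proof -
  have w: "w \<in> V"
    using assms S_subset_V by auto
  have i: "i - 1 < D"
    using assms(4) by simp
  have sub: "S (i - 1) w \<subseteq> S i v"
    using S_subset_S_Suc[OF assms(2), of "i - 1"] assms(3) by simp
  have "{..<i} = insert (i - 1) {..<i - 1}"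
    using assms(3) by auto
  then have union: "(\<Union>j<i. S j v) = S (i - 1) v \<union> (\<Union>j<i - 1. S j v)"
    by simp
  show ?thesis
  proof (cases "S (i - 1) v \<inter> S (i - 1) w = {}")
    case True
    have eq: "dist_sphere G i v \<inter> S (i - 1) w = S (i - 1) w - (\<Union>j<i - 1. S j v)"
      unfolding dist_sphere_eq union using sub True by blast
    obtain b :: "nat \<Rightarrow> nat" where b: "\<forall>j. b j \<in> {0, 1}"
      "card (dist_sphere G i v \<inter> S (i - 1) w) + (\<Sum>j<i - 1. b j * d ^ j) = d ^ (i - 1)"
      using card_S_Diff[OF assms(1) w i, folded eq] by (elim exE conjE) (rule that)
    have "real (card (dist_sphere G i v \<inter> S (i - 1) w)) + real (\<Sum>j<i - 1. b j * d ^ j) =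
        real (d ^ (i - 1))"
      using b(2) by (metis of_nat_add)
    then have "real (card (dist_sphere G i v \<inter> S (i - 1) w)) =
        real d ^ (i - 1) - (\<Sum>j<i - 1. real (b j) * real d ^ j)"
      unfolding of_nat_sum of_nat_mult of_nat_power by linarith
    then show ?thesis
      using b(1) by (intro exI[of _ 1] exI[of _ b]) simp
  next
    case False
    then have "S (i - 1) w \<subseteq> S (i - 1) v"
      using S_laminar[OF w assms(1) order_refl i] by (metis Int_commute)
    then have "dist_sphere G i v \<inter> S (i - 1) w = {}"
      unfolding dist_sphere_eq union by blast
    then show ?thesis
      by (intro exI[of _ 0] exI[of _ "\<lambda>_. 0"]) simp
  qed
qed

text \<open>The quantities \<open>p\<close> and \<open>q\<close> of the theorem, for a vertex \<open>v\<close> and its out-neighbour \<open>w\<close>.\<close>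

definition to_D_ratio :: "nat \<Rightarrow> 'a list \<Rightarrow> 'a list \<Rightarrow> real" where
  "to_D_ratio i v w =
    real (card (dist_sphere G i v \<inter> dist_sphere G D w)) / real (card (dist_sphere G i v))"

definition through_ratio :: "nat \<Rightarrow> 'a list \<Rightarrow> 'a list \<Rightarrow> real" where
  "through_ratio i v w =
    real (card (dist_sphere G i v \<inter> S (i - 1) w)) / real (card (dist_sphere G i v))"

text \<open>
  The required shape of the two fractions with all restrictions on their coefficients. The sequence
  \<open>a\<close> is shared because both denominators are the size of the same distance sphere.
\<close>

definition ratio_form ::
    "nat \<Rightarrow> real \<Rightarrow> real \<Rightarrow> nat \<Rightarrow> nat \<Rightarrow> (nat \<Rightarrow> nat) \<Rightarrow> (nat \<Rightarrow> nat) \<Rightarrow> (nat \<Rightarrow> nat) \<Rightarrow> bool" where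
  "ratio_form i p q k \<kappa> \<alpha> a b \<longleftrightarrow>
    p = real k *
      ((real d ^ i - (\<Sum>j<i. real (\<alpha> j) * real d ^ j)) /
       (real d ^ i - (\<Sum>j<i. real (a j) * real d ^ j))) \<and>
    q = real \<kappa> *
      ((real d ^ (i - 1) - (\<Sum>j<i - 1. real (b j) * real d ^ j)) /
       (real d ^ i - (\<Sum>j<i. real (a j) * real d ^ j))) \<and>
    k \<in> {0, 1} \<and> \<kappa> \<in> {0, 1} \<and> \<alpha> (i - 1) \<in> {0, 1, 2} \<and> a (i - 1) \<in> {0, 1} \<and>
    (\<forall>j<i - 1. \<alpha> j \<in> {0, 1} \<and> a j \<in> {0, 1} \<and> b j \<in> {0, 1})"

lemma card_dist_sphere:
  assumes "v \<in> V" "i < D"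
  obtains a :: "nat \<Rightarrow> nat" where "\<forall>j. a j \<in> {0, 1}"
    and "real (card (dist_sphere G i v)) = real d ^ i - (\<Sum>j<i. real (a j) * real d ^ j)"
    and "dist_sphere G i v \<noteq> {}"
proof -
  obtain a :: "nat \<Rightarrow> nat" where a: "\<forall>j. a j \<in> {0, 1}"
    "card (dist_sphere G i v) + (\<Sum>j<i. a j * d ^ j) = d ^ i"
    using card_S_Diff[OF assms(1,1,2), folded dist_sphere_eq] by (elim exE conjE) (rule that)
  have "real (card (dist_sphere G i v)) + real (\<Sum>j<i. a j * d ^ j) = real (d ^ i)"
    using a(2) by (metis of_nat_add)
  then have "real (card (dist_sphere G i v)) = real d ^ i - (\<Sum>j<i. real (a j) * real d ^ j)"
    unfolding of_nat_sum of_nat_mult of_nat_power by linarith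
  moreover have "dist_sphere G i v \<noteq> {}"
    using a(2) sum_digits_less_power[of d a i] d_ge_2 a(1) by auto
  ultimately show ?thesis
    using a(1) by (intro that)
qed

lemma ratio_form_exists:
  assumes "v \<in> V" "w \<in> S 1 v" "1 \<le> i" "i < D"
  shows "\<exists>k \<kappa> \<alpha> a b. ratio_form i (to_D_ratio i v w) (through_ratio i v w) k \<kappa> \<alpha> a b"
proof -
  obtain a :: "nat \<Rightarrow> nat" where a: "\<forall>j. a j \<in> {0, 1}"
    and card_a: "real (card (dist_sphere G i v)) = real d ^ i - (\<Sum>j<i. real (a j) * real d ^ j)"
    by (rule card_dist_sphere[OF assms(1,4)])
  obtain k :: nat and \<alpha> :: "nat \<Rightarrow> nat"
    where k: "k \<in> {0, 1}" and \<alpha>: "\<alpha> (i - 1) \<in> {0, 1, 2}" "\<forall>j<i - 1. \<alpha> j \<in> {0, 1}"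
    and card_\<alpha>: "real (card (dist_sphere G i v \<inter> dist_sphere G D w)) =
        real k * (real d ^ i - (\<Sum>j<i. real (\<alpha> j) * real d ^ j))"
    using card_deflected_to_D[OF assms] by (elim exE conjE) (rule that)
  obtain \<kappa> :: nat and b :: "nat \<Rightarrow> nat"
    where \<kappa>: "\<kappa> \<in> {0, 1}" and b: "\<forall>j. b j \<in> {0, 1}"
    and card_b: "real (card (dist_sphere G i v \<inter> S (i - 1) w)) =
        real \<kappa> * (real d ^ (i - 1) - (\<Sum>j<i - 1. real (b j) * real d ^ j))"
    using card_through_neighbour[OF assms] by (elim exE conjE) (rule that)
  have "ratio_form i (to_D_ratio i v w) (through_ratio i v w) k \<kappa> \<alpha> a b"
    unfolding ratio_form_def to_D_ratio_def through_ratio_def card_a card_\<alpha> card_b times_divide_eq_right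
    using a k \<alpha> \<kappa> b by blast
  then show ?thesis
    by blast
qed

section \<open>Invariance under permutations of the alphabet\<close>

text \<open>
  The contribution of \<open>v\<close> to the transition probability up to the constant \<open>1 / ((d - 1) |V|)\<close>; it is
  this number that depends only on the class of \<open>v\<close>.
\<close>

definition deflection_weight :: "nat \<Rightarrow> 'a list \<Rightarrow> real" where
  "deflection_weight i v = (\<Sum>w\<in>S 1 v. to_D_ratio i v w * (1 - through_ratio i v w))"

lemma trans_prob_eq_sum_weight:
  assumes "1 \<le> i" "i < D"
  shows "trans_prob G d i D =
    1 / ((real d - 1) * real (card V)) * (\<Sum>v\<in>V. deflection_weight i v)"
proof -
  have "(\<Sum>w\<in>S 1 v. trans_prob_given G i D v w * defl_prob G d i w v) =
      1 / (real d - 1) * deflection_weight i v" if v: "v \<in> V" for v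
  proof -
    have "dist_sphere G i v \<noteq> {}"
      using card_dist_sphere[OF v assms(2)] by blast
    then show ?thesis
      unfolding deflection_weight_def sum_distrib_left to_D_ratio_def through_ratio_def
      using trans_prob_given_mult_defl_prob[OF assms(1)] finite_V
      by (intro sum.cong) (simp_all add: mult.assoc)
  qed
  then have "trans_prob G d i D =
      1 / real (card V) * (\<Sum>v\<in>V. 1 / (real d - 1) * deflection_weight i v)"
    unfolding trans_prob_def by simp
  then show ?thesis
    by (simp flip: sum_divide_distrib)
qed

context
  fixes \<sigma> assumes \<sigma>: "\<sigma> permutes A"
begin

lemma inj_map_perm: "inj (map \<sigma>)"
  using permutes_inj[OF \<sigma>] by simp

lemma map_perm_in_V: "v \<in> V \<Longrightarrow> map \<sigma> v \<in> V"
  using permutes_in_image[OF \<sigma>] R_invariant[OF permutes_inj[OF \<sigma>]]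
  by (auto simp: overlap_words_def successively_map)

lemma S_map_perm: "v \<in> V \<Longrightarrow> S i (map \<sigma> v) = map \<sigma> ` S i v"
proof (induction i arbitrary: v)
  case 0
  then show ?case
    using map_perm_in_V by (simp add: walk_sphere_0)
next
  case (Suc i)
  have "{x \<in> A. R (\<sigma> (last v)) x} = \<sigma> ` {x \<in> A. R (last v) x}"
    (is "?L = ?R")
  proof
    show "?R \<subseteq> ?L"
      using permutes_in_image[OF \<sigma>] R_invariant[OF permutes_inj[OF \<sigma>]] by auto
    show "?L \<subseteq> ?R"
    proof
      fix y assume y: "y \<in> ?L"
      then obtain x where "x \<in> A" "y = \<sigma> x"
        using permutes_image[OF \<sigma>] by blast
      then show "y \<in> ?R"
        using y R_invariant[OF permutes_inj[OF \<sigma>]] by auto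
    qed
  qed
  then have "S 1 (map \<sigma> v) = map \<sigma> ` S 1 v"
    using Suc.prems map_perm_in_V word_nonempty[OF Suc.prems]
    by (simp add: S_1[simplified] last_map image_image map_tl)
  then show ?case
    unfolding walk_sphere_Suc[of i] image_UN using Suc.IH S_subset_V[of 1 v]
    by (simp add: subset_iff)
qed

lemma dist_sphere_map_perm:
  assumes "v \<in> V"
  shows "dist_sphere G i (map \<sigma> v) = map \<sigma> ` dist_sphere G i v"
  unfolding dist_sphere_eq S_map_perm[OF assms] image_set_diff[OF inj_map_perm] image_UN ..

text \<open>The substitution \<open>w \<mapsto> map \<sigma> w\<close> matches the out-neighbours of \<open>v\<close> with those of its image.\<close>

lemma deflection_weight_map_perm:
  assumes v: "v \<in> V"
  shows "deflection_weight i (map \<sigma> v) = deflection_weight i v"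
proof -
  have card: "card (map \<sigma> ` X) = card X" for X
    by (rule card_image[OF inj_on_subset[OF inj_map_perm subset_UNIV]])
  have "deflection_weight i (map \<sigma> v) =
      (\<Sum>w\<in>S 1 v. to_D_ratio i (map \<sigma> v) (map \<sigma> w) * (1 - through_ratio i (map \<sigma> v) (map \<sigma> w)))"
    unfolding deflection_weight_def S_map_perm[OF v]
    by (simp add: sum.reindex[OF inj_on_subset[OF inj_map_perm subset_UNIV]])
  also have "\<dots> = deflection_weight i v"
    unfolding deflection_weight_def
  proof (intro sum.cong refl)
    fix w assume "w \<in> S 1 v"
    then have w: "w \<in> V"
      using S_subset_V by auto
    show "to_D_ratio i (map \<sigma> v) (map \<sigma> w) * (1 - through_ratio i (map \<sigma> v) (map \<sigma> w)) =
        to_D_ratio i v w * (1 - through_ratio i v w)"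
      unfolding to_D_ratio_def through_ratio_def dist_sphere_map_perm[OF v]
        dist_sphere_map_perm[OF w] S_map_perm[OF w] image_Int[OF inj_map_perm, symmetric] card ..
  qed
  finally show ?thesis .
qed

end

lemma equiv_word_equiv: "equiv V (word_equiv A V)"
proof (rule equivI)
  show "word_equiv A V \<subseteq> V \<times> V"
    by (auto simp: word_equiv_def)
  show "refl_on V (word_equiv A V)"
    by (auto simp: refl_on_def word_equiv_def intro!: exI[of _ id] permutes_id)
  show "sym (word_equiv A V)"
  proof (rule symI)
    fix v v' assume "(v, v') \<in> word_equiv A V"
    then obtain \<sigma> where \<sigma>: "v \<in> V" "v' \<in> V" "\<sigma> permutes A" "map \<sigma> v = v'"
      by (auto simp: word_equiv_def)
    then have "map (inv \<sigma>) v' = v"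
      using permutes_inv_o(2)[OF \<sigma>(3)] by auto
    then show "(v', v) \<in> word_equiv A V"
      using \<sigma> permutes_inv by (auto simp: word_equiv_def)
  qed
  show "trans (word_equiv A V)"
  proof (rule transI)
    fix u v w assume "(u, v) \<in> word_equiv A V" "(v, w) \<in> word_equiv A V"
    then obtain \<sigma> \<tau> where "\<sigma> permutes A" "\<tau> permutes A" "u \<in> V" "w \<in> V" "map \<tau> (map \<sigma> u) = w"
      by (auto simp: word_equiv_def)
    then show "(u, w) \<in> word_equiv A V"
      using permutes_compose by (fastforce simp: word_equiv_def)
  qed
qed

lemma sum_weight_by_classes:
  assumes bij: "bij_betw \<V> {1..l::nat} (V // word_equiv A V)"
    and rep: "\<And>r. r \<in> {1..l} \<Longrightarrow> rep r \<in> \<V> r"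
  shows "(\<Sum>v\<in>V. deflection_weight i v) =
    (\<Sum>r = 1..l. real (card (\<V> r)) * deflection_weight i (rep r))"
proof -
  let ?Q = "V // word_equiv A V"
  have const: "deflection_weight i v = deflection_weight i u" if "X \<in> ?Q" "u \<in> X" "v \<in> X" for X u v
  proof -
    have "(u, v) \<in> word_equiv A V"
      using that quotient_eq_iff[OF equiv_word_equiv, of X X u v] by simp
    then show ?thesis
      using deflection_weight_map_perm by (auto simp: word_equiv_def)
  qed
  have fin: "\<forall>X\<in>?Q. finite X"
    using finite_V Union_quotient[OF equiv_word_equiv] by (metis Union_upper finite_subset)
  have "(\<Sum>v\<in>V. deflection_weight i v) = (\<Sum>v\<in>\<Union>?Q. deflection_weight i v)"
    by (simp add: Union_quotient[OF equiv_word_equiv])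
  also have "\<dots> = (\<Sum>X\<in>?Q. \<Sum>v\<in>X. deflection_weight i v)"
    using fin quotient_disj[OF equiv_word_equiv] by (subst sum.Union_disjoint) auto
  also have "\<dots> = (\<Sum>r = 1..l. \<Sum>v\<in>\<V> r. deflection_weight i v)"
    using sum.reindex_bij_betw[OF bij] by metis
  also have "\<dots> = (\<Sum>r = 1..l. real (card (\<V> r)) * deflection_weight i (rep r))"
  proof (intro sum.cong refl)
    fix r assume r: "r \<in> {1..l}"
    then have "\<V> r \<in> ?Q"
      using bij by (auto simp: bij_betw_def)
    then have "(\<Sum>v\<in>\<V> r. deflection_weight i v) = (\<Sum>v\<in>\<V> r. deflection_weight i (rep r))"
      using const rep[OF r] by (intro sum.cong refl) blast
    then show "(\<Sum>v\<in>\<V> r. deflection_weight i v) = real (card (\<V> r)) * deflection_weight i (rep r)"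
      by simp
  qed
  finally show ?thesis .
qed

text \<open>
  For the \<open>r\<close>-th class a representative is chosen, and its \<open>d\<close> out-neighbours are enumerated as
  \<open>w\<^sub>1, \<dots>, w\<^sub>d\<close>; \<open>p\<close> and \<open>q\<close> for \<open>(r, s)\<close> are the ratios of the representative and \<open>w\<^sub>s\<close>.
\<close>

theorem trans_prob_to_diameter:
  assumes bij: "bij_betw \<V> {1..l::nat} (V // word_equiv A V)"
  shows "\<exists>p q k \<kappa> \<alpha> a b. \<forall>i. 1 \<le> i \<and> i < D \<longrightarrow>
      trans_prob G d i D =
        1 / ((real d - 1) * real (card V)) *
        (\<Sum>r = 1..l. \<Sum>s = 1..d. real (card (\<V> r)) * p r s i * (1 - q r s i)) \<and>
      (\<forall>r\<in>{1..l}. \<forall>s\<in>{1..d}.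
        ratio_form i (p r s i) (q r s i) (k r s i) (\<kappa> r s i) (\<alpha> r s i) (a r s i) (b r s i))"
proof -
  have is_class: "\<V> r \<in> V // word_equiv A V" if "r \<in> {1..l}" for r
    using bij that by (auto simp: bij_betw_def)
  define rep where "rep r = (SOME v. v \<in> \<V> r)" for r
  have rep: "rep r \<in> \<V> r" if "r \<in> {1..l}" for r
    unfolding rep_def using in_quotient_imp_non_empty[OF equiv_word_equiv is_class[OF that]]
    by (simp add: some_in_eq)
  have rep_V: "rep r \<in> V" if "r \<in> {1..l}" for r
    using rep[OF that] is_class[OF that] in_quotient_imp_subset[OF equiv_word_equiv] by blast
  obtain nb where nb: "bij_betw (nb v) {1..d} (S 1 v)" if "v \<in> V" for v
    using ex_bij_betw_nat_finite_1[OF finite_S] card_S_1 by metis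
  define p where "p r s i = to_D_ratio i (rep r) (nb (rep r) s)" for r s i
  define q where "q r s i = through_ratio i (rep r) (nb (rep r) s)" for r s i
  have "\<forall>r s i. \<exists>k \<kappa> \<alpha> a b. r \<in> {1..l} \<and> s \<in> {1..d} \<and> 1 \<le> i \<and> i < D \<longrightarrow>
      ratio_form i (p r s i) (q r s i) k \<kappa> \<alpha> a b"
  proof (intro allI)
    fix r s i
    show "\<exists>k \<kappa> \<alpha> a b. r \<in> {1..l} \<and> s \<in> {1..d} \<and> 1 \<le> i \<and> i < D \<longrightarrow>
      ratio_form i (p r s i) (q r s i) k \<kappa> \<alpha> a b"
    proof (cases "r \<in> {1..l} \<and> s \<in> {1..d} \<and> 1 \<le> i \<and> i < D")
      case True
      then have "nb (rep r) s \<in> S 1 (rep r)"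
        using bij_betw_apply[OF nb[OF rep_V]] by blast
      then show ?thesis
        using True ratio_form_exists[OF rep_V] unfolding p_def q_def by meson
    qed auto
  qed
  then obtain k \<kappa> \<alpha> a b where coeffs: "\<forall>r s i. r \<in> {1..l} \<and> s \<in> {1..d} \<and> 1 \<le> i \<and> i < D \<longrightarrow>
      ratio_form i (p r s i) (q r s i) (k r s i) (\<kappa> r s i) (\<alpha> r s i) (a r s i) (b r s i)"
    by metis
  have weight: "(\<Sum>v\<in>V. deflection_weight i v) =
      (\<Sum>r = 1..l. \<Sum>s = 1..d. real (card (\<V> r)) * p r s i * (1 - q r s i))" for i
  proof -
    have "deflection_weight i (rep r) = (\<Sum>s = 1..d. p r s i * (1 - q r s i))" if "r \<in> {1..l}" for r
      unfolding deflection_weight_def p_def q_def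
      using sum.reindex_bij_betw[OF nb[OF rep_V[OF that]], symmetric] .
    moreover have "(\<Sum>v\<in>V. deflection_weight i v) =
        (\<Sum>r = 1..l. real (card (\<V> r)) * deflection_weight i (rep r))"
      using bij rep by (rule sum_weight_by_classes)
    ultimately show ?thesis
      by (simp add: sum_distrib_left mult.assoc)
  qed
  have prob: "trans_prob G d i D =
        1 / ((real d - 1) * real (card V)) *
        (\<Sum>r = 1..l. \<Sum>s = 1..d. real (card (\<V> r)) * p r s i * (1 - q r s i))"
    if "1 \<le> i \<and> i < D" for i
    using that trans_prob_eq_sum_weight[of i] unfolding weight by blast
  show ?thesis
    by (intro exI[of _ p] exI[of _ q] exI[of _ k] exI[of _ \<kappa>] exI[of _ \<alpha>] exI[of _ a] exI[of _ b]
        allI impI conjI ballI prob coeffs[rule_format]) auto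
qed

end

theorem theorem6:
  fixes A :: "'a set"
    and G :: "('a list, 'a list \<times> 'a list) pre_digraph"
    and d D l :: nat
    and \<V> :: "nat \<Rightarrow> 'a list set"
  assumes "d \<ge> 2" and "D \<ge> 1" and "finite A"
    and "(G = de_bruijn A D \<and> card A = d) \<or> (G = kautz A D \<and> card A = d + 1)"
    and "bij_betw \<V> {1..l} (verts G // word_equiv A (verts G))"
  shows "\<exists>(m :: nat \<Rightarrow> nat)
            (p :: nat \<Rightarrow> nat \<Rightarrow> nat \<Rightarrow> real) (q :: nat \<Rightarrow> nat \<Rightarrow> nat \<Rightarrow> real)
            (k :: nat \<Rightarrow> nat \<Rightarrow> nat \<Rightarrow> nat) (\<kappa> :: nat \<Rightarrow> nat \<Rightarrow> nat \<Rightarrow> nat)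
            (\<alpha> :: nat \<Rightarrow> nat \<Rightarrow> nat \<Rightarrow> nat \<Rightarrow> nat)
            (a :: nat \<Rightarrow> nat \<Rightarrow> nat \<Rightarrow> nat \<Rightarrow> nat)
            (b :: nat \<Rightarrow> nat \<Rightarrow> nat \<Rightarrow> nat \<Rightarrow> nat).
    (\<forall>r\<in>{1..l}. (G = kautz A D \<longrightarrow> m r \<in> {d - 1, d}) \<and> (G = de_bruijn A D \<longrightarrow> m r = d)) \<and>
    (\<forall>i. 1 \<le> i \<and> i < D \<longrightarrow>
      trans_prob G d i D =
        1 / ((real d - 1) * real (card (verts G))) *
        (\<Sum>r = 1..l. \<Sum>s = 1..m r. real (card (\<V> r)) * p r s i * (1 - q r s i)) \<and>
      (\<forall>r\<in>{1..l}. \<forall>s\<in>{1..m r}.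
        p r s i = real (k r s i) *
          ((real d ^ i - (\<Sum>j<i. real (\<alpha> r s i j) * real d ^ j)) /
           (real d ^ i - (\<Sum>j<i. real (a r s i j) * real d ^ j))) \<and>
        q r s i = real (\<kappa> r s i) *
          ((real d ^ (i - 1) - (\<Sum>j<i - 1. real (b r s i j) * real d ^ j)) /
           (real d ^ i - (\<Sum>j<i. real (a r s i j) * real d ^ j))) \<and>
        k r s i \<in> {0, 1} \<and> \<kappa> r s i \<in> {0, 1} \<and>
        \<alpha> r s i (i - 1) \<in> {0, 1, 2} \<and> a r s i (i - 1) \<in> {0, 1} \<and>
        (\<forall>j<i - 1. \<alpha> r s i j \<in> {0, 1} \<and> a r s i j \<in> {0, 1} \<and> b r s i j \<in> {0, 1})))"
proof -
  obtain R where G: "G = overlap_digraph R A D" and "word_digraph R A d D"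
  proof (cases "G = de_bruijn A D \<and> card A = d")
    case True
    have "word_digraph (\<lambda>_ _. True) A d D"
      using assms(1-3) True by unfold_locales auto
    then show ?thesis
      using that True de_bruijn_eq_overlap_digraph by blast
  next
    case False
    then have kautz: "G = kautz A D" "card A = d + 1"
      using assms(4) by auto
    have "{x \<in> A. a \<noteq> x} = A - {a}" for a
      by auto
    then have "word_digraph (\<noteq>) A d D"
      using assms(1-3) kautz by unfold_locales (auto simp: inj_eq)
    then show ?thesis
      using that kautz kautz_eq_overlap_digraph by blast
  qed
  then interpret word_digraph R A d D
    by simp
  show ?thesis
    using trans_prob_to_diameter[of \<V> l] assms(5) unfolding G verts_G ratio_form_def
    by (intro exI[of _ "\<lambda>_. d"]) simp
qed

end
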